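(* Let $H = \overline{P_5}$ be the house. Then $rb(K_n, H) = \Theta(n^{3/2})$.
   Context: The house $H$ is the complement of the path $P_5$ on five vertices (a $5$-cycle with one chord). For a graph $F$ and an integer $n$, the rainbow number $rb(K_n,F)$ is the minimum number $m$ such that every edge-colouring of $K_n$ using at least $m$ colours contains a rainbow copy of $F$ (a subgraph isomorphic to $F$ whose edges all have distinct colours). The asymptotics are as $n \to \infty$. *)

theory Defs
  imports Complex_Main "HOL-Library.Landau_Symbols"
begin

(* A simple undirected graph is a vertex set together with a set of two-element subsets of it. *)
type_synonym 'a sgraph = "'a set \<times> 'a set set"

abbreviation verts :: "'a sgraph \<Rightarrow> 'a set" where
  "verts G \<equiv> fst G"

abbreviation edges :: "'a sgraph \<Rightarrow> 'a set set" where
  "edges G \<equiv> snd G"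

definition simple_graph :: "'a sgraph \<Rightarrow> bool" where
  "simple_graph G \<longleftrightarrow> (\<forall>e\<in>edges G. e \<subseteq> verts G \<and> card e = 2)"

definition subgraph :: "'a sgraph \<Rightarrow> 'a sgraph \<Rightarrow> bool" where
  "subgraph S G \<longleftrightarrow> simple_graph S \<and> verts S \<subseteq> verts G \<and> edges S \<subseteq> edges G"

definition isomorphic :: "'a sgraph \<Rightarrow> 'b sgraph \<Rightarrow> bool" where
  "isomorphic G H \<longleftrightarrow>
     (\<exists>f. bij_betw f (verts G) (verts H) \<and>
          (\<forall>u\<in>verts G. \<forall>v\<in>verts G. {u, v} \<in> edges G \<longleftrightarrow> {f u, f v} \<in> edges H))"

definition complement :: "'a sgraph \<Rightarrow> 'a sgraph" where
  "complement G = (verts G, {e. e \<subseteq> verts G \<and> card e = 2} - edges G)"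

definition complete_graph :: "nat \<Rightarrow> nat sgraph" where
  "complete_graph n = ({..<n}, {e. e \<subseteq> {..<n} \<and> card e = 2})"

(* k counts vertices, not edges. *)
definition path_graph :: "nat \<Rightarrow> nat sgraph" where
  "path_graph k = ({..<k}, {{i, Suc i} | i. Suc i < k})"

definition house :: "nat sgraph" where
  "house = complement (path_graph 5)"

(* Only the values of c on the edges of G matter. *)
definition num_colours :: "'a sgraph \<Rightarrow> ('a set \<Rightarrow> 'c) \<Rightarrow> nat" where
  "num_colours G c = card (c ` edges G)"

definition has_rainbow_copy :: "'a sgraph \<Rightarrow> ('a set \<Rightarrow> 'c) \<Rightarrow> 'b sgraph \<Rightarrow> bool" where
  "has_rainbow_copy G c F \<longleftrightarrow> (\<exists>S. subgraph S G \<and> isomorphic S F \<and> inj_on c (edges S))"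

(* Natural numbers suffice as colours, since a finite graph has finitely many edges.
   The minimum is over a nonempty set: no colouring of G uses more than card (edges G)
   colours, so m = card (edges G) + 1 always qualifies (vacuously). *)
definition rainbow_number :: "nat sgraph \<Rightarrow> 'b sgraph \<Rightarrow> nat" where
  "rainbow_number G F =
     (LEAST m. \<forall>c :: nat set \<Rightarrow> nat. num_colours G c \<ge> m \<longrightarrow> has_rainbow_copy G c F)"

end

theory Submission
  imports Defs "HOL-Algebra.Algebraic_Closure_Type" "HOL-Library.Z2" "HOL-Analysis.Convex"
begin

text \<open>Upper bound: choosing one edge of each colour gives a rainbow graph with at least
  \<open>3 n\<^bsup>3/2\<^esup>\<close> edges, which contains a copy of \<open>K\<^bsub>2,4\<^esub>\<close> by the
  Kovari-Sos-Turan argument. Let \<open>u, v\<close> be its two vertices of degree 4 and \<open>x1, x2\<close> two of the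
  others. If no rainbow house contains the edge \<open>x1 x2\<close>, then the houses whose triangle
  is \<open>u x1 x2\<close> force its colour to be that of \<open>u x1\<close> or \<open>u x2\<close>; in the same way it must
  be that of \<open>v x1\<close> or \<open>v x2\<close>, a contradiction.

  Lower bound: take the incidence graph of the points \<open>(x, y)\<close> and the lines \<open>y = a x + b\<close> over
  the field with \<open>q = 2\<^sup>k\<close> elements, colour its \<open>q\<^sup>3\<close> edges differently and all other edges with one
  further colour. A rainbow house has at most one edge outside this graph; but the graph is bipartite and has no
  4-cycle, whereas every house minus an edge contains a cycle of length 3, 4 or 5. Using powers of 2
  instead of primes avoids any result on the distribution of primes.\<close>

section \<open>Finite fields of characteristic 2 and their point-line incidence graphs\<close>

text \<open>\<open>K\<close> consists of the roots of \<open>X^q - X\<close> in the algebraic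
  closure of the two-element field. The derivative of this polynomial has no root, so the
  \<open>q\<close> roots are distinct. Closure under sums and products is all that is recorded;
  differences are formed in the ambient field.\<close>

lemma finite_subfield_exists:
  fixes q :: nat
  assumes "q = 2 ^ k" "k \<ge> 1"
  obtains K :: "bit alg_closure set"
  where "finite K" "card K = q" "\<And>x y. x \<in> K \<Longrightarrow> y \<in> K \<Longrightarrow> x + y \<in> K"
    "\<And>x y. x \<in> K \<Longrightarrow> y \<in> K \<Longrightarrow> x * y \<in> K"
proof -
  have char_bit: "CHAR(bit) = 2"
  proof (rule CHAR_eq_posI)
    show "of_nat x \<noteq> (0::bit)" if "x > 0" "x < 2" for x
      using that by (cases "x = 1") auto
  qed auto
  hence char: "CHAR(bit alg_closure) = 2" by simp
  have "q \<ge> 2" using assms power_increasing[of 1 k "2::nat"] by simp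
  define p :: "bit alg_closure poly" where "p = monom 1 q - monom 1 1"
  have coeff_p: "coeff p q = 1" using \<open>q \<ge> 2\<close> by (simp add: p_def)
  hence "p \<noteq> 0" by auto
  have deg: "degree p = q"
  proof (rule antisym)
    show "degree p \<le> q" unfolding p_def
      using \<open>q \<ge> 2\<close> by (intro degree_diff_le) (auto simp: degree_monom_eq)
    show "q \<le> degree p" using coeff_p by (intro le_degree) simp
  qed
  have poly_p: "poly p x = x ^ q - x" for x
    by (simp add: p_def poly_monom)
  have "CHAR(bit alg_closure) dvd q"
    unfolding char using assms by simp
  hence "of_nat q = (0 :: bit alg_closure)"
    by (simp only: of_nat_eq_0_iff_char_dvd)
  \<comment> \<open>The derivative is \<open>q X^(q-1) - 1\<close>, and \<open>q\<close> vanishes in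
    characteristic 2.\<close>
  hence deriv_p: "pderiv p = - 1"
    by (simp add: p_def pderiv_diff pderiv_monom monom_0 one_pCons)
  obtain A where A: "size A = degree p" "p = smult (lead_coeff p) (\<Prod>x\<in>#A. [:-x, 1:])"
    using alg_closed_imp_factorization[OF \<open>p \<noteq> 0\<close>] by blast
  have A2: "p = (\<Prod>x\<in>#A. [:-x, 1:])" using A(2) coeff_p deg by simp
  have cnt: "count A x = 1" if "x \<in># A" for x
  proof (rule ccontr)
    \<comment> \<open>A repeated root would also be a root of the derivative.\<close>
    assume "count A x \<noteq> 1"
    with that obtain B where B: "A = add_mset x (add_mset x B)"
      by (metis One_nat_def count_add_mset count_eq_zero_iff multi_member_split)
    define l r where "l = [:-x, 1:]" and "r = (\<Prod>x\<in>#B. [:-x, 1:])"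
    have "p = l * (l * r)"
      unfolding A2 B l_def r_def by (simp only: image_mset_add_mset prod_mset.add_mset)
    moreover have "poly l x = 0" by (simp add: l_def)
    ultimately have "poly (pderiv p) x = 0" by (simp add: pderiv_mult)
    thus False by (simp add: deriv_p)
  qed
  have roots: "set_mset A = {x. x ^ q = x}"
  proof -
    have "x \<in># A \<longleftrightarrow> poly p x = 0" for x
      unfolding A2 by (induction A) auto
    thus ?thesis by (auto simp: poly_p)
  qed
  have "card (set_mset A) = q"
  proof -
    have "size A = (\<Sum>x\<in>set_mset A. 1)"
      unfolding size_multiset_overloaded_eq by (intro sum.cong) (auto simp: cnt)
    thus ?thesis using A(1) deg by simp
  qed
  \<comment> \<open>Since \<open>q\<close> is a power of the characteristic, the \<open>q\<close>-th
    power map is additive, so its fixed points are closed under addition.\<close>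
  moreover have "(x + y) ^ q = x ^ q + y ^ q" for x y :: "bit alg_closure"
    by (rule freshmans_dream'[where n = k]) (simp_all add: char_bit assms)
  moreover have "finite {x :: bit alg_closure. x ^ q = x}"
    using finite_set_mset[of A] unfolding roots .
  ultimately show ?thesis
    using that[of "set_mset A"] by (simp add: roots power_mult_distrib)
qed

text \<open>Lines \<open>(a, b)\<close> become the numbers below \<open>q^2\<close>, points
  \<open>(x, y)\<close> those from \<open>q^2\<close> on. A 4-cycle would be two distinct lines
  through two distinct points.\<close>

lemma C4_free_bipartite_exists:
  fixes q :: nat
  assumes "q = 2 ^ k" "k \<ge> 1"
  obtains E where "E \<subseteq> {..<q\<^sup>2} \<times> {q\<^sup>2..<2 * q\<^sup>2}" "card E = q ^ 3"
    "\<And>i i' j j'. \<lbrakk>(i, j) \<in> E; (i, j') \<in> E; (i', j) \<in> E; (i', j') \<in> E\<rbrakk> \<Longrightarrow> i = i' \<or> j = j'"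
proof -
  obtain K :: "bit alg_closure set" where K: "finite K" "card K = q"
    "\<And>x y. x \<in> K \<Longrightarrow> y \<in> K \<Longrightarrow> x + y \<in> K" "\<And>x y. x \<in> K \<Longrightarrow> y \<in> K \<Longrightarrow> x * y \<in> K"
    using finite_subfield_exists[OF assms] by blast
  obtain h where "bij_betw h (K \<times> K) {0..<card (K \<times> K)}"
    using ex_bij_betw_finite_nat[of "K \<times> K"] K(1) by auto
  hence h: "inj_on h (K \<times> K)" "h ` (K \<times> K) = {..<q\<^sup>2}"
    by (auto simp: bij_betw_def card_cartesian_product K(2) power2_eq_square atLeast0LessThan)
  hence h_less: "h z < q\<^sup>2" if "z \<in> K \<times> K" for z using that by blast
  \<comment> \<open>The triple \<open>(a, b, x)\<close> stands for the incidence of the line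
    \<open>y = a x + b\<close> with its point at abscissa \<open>x\<close>; hence there are
    \<open>q^3\<close> edges.\<close>
  define g where "g = (\<lambda>(a, b, x). (h (a, b), q\<^sup>2 + h (x, a * x + b)))"
  have inj: "inj_on g (K \<times> K \<times> K)"
    using K(3,4) by (auto simp: g_def inj_on_def dest!: inj_onD[OF h(1)])
  show ?thesis
  proof
    show "g ` (K \<times> K \<times> K) \<subseteq> {..<q\<^sup>2} \<times> {q\<^sup>2..<2 * q\<^sup>2}"
      using h_less K(3,4) by (auto simp: g_def)
    show "card (g ` (K \<times> K \<times> K)) = q ^ 3"
      by (simp add: card_image[OF inj] card_cartesian_product K(2) power3_eq_cube)
    fix i i' j j'
    assume *: "(i, j) \<in> g ` (K \<times> K \<times> K)" "(i, j') \<in> g ` (K \<times> K \<times> K)"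
      "(i', j) \<in> g ` (K \<times> K \<times> K)" "(i', j') \<in> g ` (K \<times> K \<times> K)"
    have ex: "\<exists>a b. a \<in> K \<and> b \<in> K \<and> l = h (a, b)"
      and ex': "\<exists>x y. x \<in> K \<and> y \<in> K \<and> m = q\<^sup>2 + h (x, y)"
      if "(l, m) \<in> g ` (K \<times> K \<times> K)" for l m
      using that by (auto simp: g_def) (metis K(3) K(4))
    have inc: "y = a * x + b"
      if "(h (a, b), q\<^sup>2 + h (x, y)) \<in> g ` (K \<times> K \<times> K)" "a \<in> K" "b \<in> K" "x \<in> K" "y \<in> K"
      for a b x y
      using that K(3,4) by (auto simp: g_def dest!: inj_onD[OF h(1)])
    obtain a b a' b' where l: "a \<in> K" "b \<in> K" "i = h (a, b)" "a' \<in> K" "b' \<in> K" "i' = h (a', b')"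
      using ex[OF *(1)] ex[OF *(3)] by blast
    obtain x y x' y' where m: "x \<in> K" "y \<in> K" "j = q\<^sup>2 + h (x, y)"
        "x' \<in> K" "y' \<in> K" "j' = q\<^sup>2 + h (x', y')"
      using ex'[OF *(1)] ex'[OF *(2)] by blast
    have e: "y = a * x + b" "y' = a * x' + b" "y = a' * x + b'" "y' = a' * x' + b'"
      using * l m by (auto intro!: inc)
    \<comment> \<open>By \<open>e\<close> the right-hand side is \<open>y - y' - y + y'\<close>. As
      a field has no zero divisors, either the slopes agree, and then the lines, or the abscissae
      agree, and then the points.\<close>
    have "(a - a') * (x - x') = (a * x + b) - (a * x' + b) - (a' * x + b') + (a' * x' + b')"
      by (simp add: algebra_simps)
    also have "\<dots> = 0" unfolding e[symmetric] by simp
    finally have "(a - a') * (x - x') = 0" .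
    hence "a = a' \<and> b = b' \<or> x = x' \<and> y = y'" using e by auto
    thus "i = i' \<or> j = j'" using l m by auto
  qed
qed

section \<open>Kovari-Sos-Turan counting\<close>

text \<open>Count triples \<open>(u, w, w')\<close> with \<open>w\<close> and \<open>w'\<close> in
  \<open>N u\<close>. Summed over \<open>u\<close> first, they number the sum of the squared
  degrees; summed over pairs \<open>(w, w')\<close>, the diagonal gives the sum of the degrees and
  every other pair at most \<open>t\<close>. Cauchy-Schwarz then bounds the square of the degree
  sum.\<close>

lemma sum_degrees_squared_le:
  fixes N :: "'a \<Rightarrow> 'b set"
  assumes "finite U" "finite W" and N: "\<And>u. u \<in> U \<Longrightarrow> N u \<subseteq> W"
    and codeg: "\<And>w w'. w \<in> W \<Longrightarrow> w' \<in> W \<Longrightarrow> w \<noteq> w' \<Longrightarrow> card {u \<in> U. w \<in> N u \<and> w' \<in> N u} \<le> t"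
  shows "(\<Sum>u\<in>U. card (N u))\<^sup>2 \<le> card U * ((\<Sum>u\<in>U. card (N u)) + t * (card W)\<^sup>2)"
proof -
  have deg: "card (N u) = (\<Sum>w\<in>W. of_bool (w \<in> N u))" if "u \<in> U" for u
    using N[OF that] \<open>finite W\<close> by (simp add: Int_absorb1)
  have "(\<Sum>u\<in>U. (card (N u))\<^sup>2) = (\<Sum>u\<in>U. \<Sum>w\<in>W. \<Sum>w'\<in>W. of_bool (w \<in> N u \<and> w' \<in> N u))"
    by (intro sum.cong) (simp_all add: deg power2_eq_square sum_product of_bool_conj del: sum_of_bool_eq)
  also have "\<dots> = (\<Sum>w\<in>W. \<Sum>w'\<in>W. \<Sum>u\<in>U. of_bool (w \<in> N u \<and> w' \<in> N u))"
    by (subst sum.swap, intro sum.cong refl, rule sum.swap)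
  \<comment> \<open>Granting \<open>t\<close> to the diagonal pairs as well costs little and makes
    the sum split.\<close>
  also have "\<dots> \<le> (\<Sum>w\<in>W. \<Sum>w'\<in>W. (if w = w' then \<Sum>u\<in>U. of_bool (w \<in> N u) else 0) + t)"
  proof (intro sum_mono)
    fix w w' assume "w \<in> W" "w' \<in> W"
    thus "(\<Sum>u\<in>U. of_bool (w \<in> N u \<and> w' \<in> N u))
        \<le> (if w = w' then \<Sum>u\<in>U. of_bool (w \<in> N u) else 0) + t"
      using codeg[of w w'] \<open>finite U\<close> by (auto simp: Int_def)
  qed
  also have "\<dots> = (\<Sum>w\<in>W. \<Sum>u\<in>U. of_bool (w \<in> N u)) + t * (card W)\<^sup>2"
    using \<open>finite W\<close> by (simp add: sum.distrib power2_eq_square del: sum_of_bool_eq)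
  also have "(\<Sum>w\<in>W. \<Sum>u\<in>U. of_bool (w \<in> N u)) = (\<Sum>u\<in>U. card (N u))"
    by (subst sum.swap) (simp add: deg del: sum_of_bool_eq)
  finally have *: "(\<Sum>u\<in>U. (card (N u))\<^sup>2) \<le> (\<Sum>u\<in>U. card (N u)) + t * (card W)\<^sup>2" .
  have "(\<Sum>u\<in>U. real (card (N u)))\<^sup>2 \<le> (\<Sum>u\<in>U. (real (card (N u)))\<^sup>2) * card U"
    by (rule sum_squared_le_sum_of_squares)
  hence "real ((\<Sum>u\<in>U. card (N u))\<^sup>2) \<le> real ((\<Sum>u\<in>U. (card (N u))\<^sup>2) * card U)"
    by simp
  hence "(\<Sum>u\<in>U. card (N u))\<^sup>2 \<le> (\<Sum>u\<in>U. (card (N u))\<^sup>2) * card U"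
    by (simp only: of_nat_le_iff)
  also have "\<dots> \<le> card U * ((\<Sum>u\<in>U. card (N u)) + t * (card W)\<^sup>2)"
    using * by simp
  finally show ?thesis .
qed

lemma card_2_ordered:
  fixes e :: "'a :: linorder set"
  assumes "e \<subseteq> A" "card e = 2"
  obtains i j where "e = {i, j}" "i < j" "i \<in> A" "j \<in> A"
proof -
  obtain x y where xy: "e = {x, y}" "x \<noteq> y"
    using assms(2) unfolding card_2_iff by blast
  show ?thesis
  proof (cases "x < y")
    case True
    thus ?thesis using that[of x y] xy assms(1) by simp
  next
    case False
    thus ?thesis using that[of y x] xy assms(1) by (simp add: insert_commute)
  qed
qed

lemma power2_powr_three_halves:
  fixes x :: real
  assumes "x > 0"
  shows "(x\<^sup>2) powr (3/2) = x ^ 3"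
proof -
  have "(x\<^sup>2) powr (3/2) = (x powr 2) powr (3/2)" using assms by simp
  also have "\<dots> = x powr 3" unfolding powr_powr by simp
  finally show ?thesis using assms by simp
qed

text \<open>If all codegrees were at most 3, the counting bound with \<open>t = 3\<close> would give
  \<open>m^2 \<le> n m + 3 n^3\<close> for \<open>m = card R\<close>, which fails once
  \<open>m\<close> reaches \<open>3 n^(3/2)\<close>.\<close>

lemma codegree_4_exists:
  assumes R: "R \<subseteq> edges (complete_graph n)" and n: "n \<ge> 1" and big: "real (card R) \<ge> 3 * real n powr (3/2)"
  obtains w w' where "w < n" "w' < n" "w \<noteq> w'" "card {u \<in> {..<n}. {u, w} \<in> R \<and> {u, w'} \<in> R} \<ge> 4"
proof (rule ccontr)
  note pair = that
  assume "\<not> thesis"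
  hence codeg: "card {u \<in> {..<n}. {u, w} \<in> R \<and> {u, w'} \<in> R} \<le> 3"
    if "w < n" "w' < n" "w \<noteq> w'" for w w'
    using \<open>\<not> thesis\<close> pair[of w w'] that by linarith
  \<comment> \<open>Only the larger neighbours are kept, so each edge is counted once and the
    degrees sum to \<open>card R\<close>; codegrees can only shrink.\<close>
  define N where "N u = {w. w < n \<and> u < w \<and> {u, w} \<in> R}" for u
  have "bij_betw (\<lambda>(u, w). {u, w}) (Sigma {..<n} N) R"
  proof (rule bij_betwI')
    fix e assume "e \<in> R"
    hence "e \<subseteq> {..<n}" "card e = 2" using R by (auto simp: complete_graph_def)
    then obtain u w where e: "e = {u, w}" "u < w" "u \<in> {..<n}" "w \<in> {..<n}"
      by (rule card_2_ordered)
    thus "\<exists>z\<in>Sigma {..<n} N. e = (case z of (u, w) \<Rightarrow> {u, w})"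
      using \<open>e \<in> R\<close> by (intro bexI[of _ "(u, w)"]) (auto simp: N_def)
  qed (auto simp: N_def doubleton_eq_iff)
  hence "card R = card (Sigma {..<n} N)" by (simp add: bij_betw_same_card)
  hence card_R: "card R = (\<Sum>u<n. card (N u))" by (simp add: N_def)
  have "(card R)\<^sup>2 \<le> n * (card R + 3 * n\<^sup>2)"
  proof -
    have "card {u \<in> {..<n}. w \<in> N u \<and> w' \<in> N u} \<le> 3"
      if "w \<in> {..<n}" "w' \<in> {..<n}" "w \<noteq> w'" for w w'
    proof -
      have "card {u \<in> {..<n}. w \<in> N u \<and> w' \<in> N u} \<le> card {u \<in> {..<n}. {u, w} \<in> R \<and> {u, w'} \<in> R}"
        by (intro card_mono) (auto simp: N_def)
      thus ?thesis using codeg[of w w'] that by simp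
    qed
    from sum_degrees_squared_le[of "{..<n}" "{..<n}" N 3, OF _ _ _ this]
    show ?thesis by (auto simp: card_R N_def)
  qed
  hence le: "(real (card R))\<^sup>2 \<le> real n * (real (card R) + 3 * (real n)\<^sup>2)"
    by (metis (mono_tags) of_nat_le_iff of_nat_mult of_nat_add of_nat_power of_nat_numeral)
  \<comment> \<open>With \<open>s = sqrt n\<close> all exponents become integral:
    \<open>n^(3/2)\<close> is \<open>s^3\<close>.\<close>
  define s m where "s = sqrt (real n)" and "m = real (card R)"
  have s: "s \<ge> 1" "real n = s\<^sup>2" using n by (simp_all add: s_def)
  have "real n powr (3/2) = s ^ 3"
    using power2_powr_three_halves[of s] s by simp
  hence m: "m \<ge> 3 * s ^ 3" using big by (simp add: m_def)
  have "s ^ 3 \<ge> s\<^sup>2" "s ^ 3 \<ge> 1" using s by (simp_all add: power_increasing)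
  hence "3 * s\<^sup>2 * m \<le> m * m" using m by (intro mult_right_mono) auto
  moreover have "(3 * s ^ 3)\<^sup>2 \<le> m\<^sup>2" using m s by (intro power_mono) auto
  hence "9 * s ^ 6 \<le> m\<^sup>2" by (simp add: power_mult_distrib flip: power_mult)
  moreover have "m\<^sup>2 \<le> s\<^sup>2 * m + 3 * s ^ 6"
    using le by (simp add: s m_def algebra_simps eval_nat_numeral)
  \<comment> \<open>Both \<open>s^2 m\<close> and \<open>3 s^6\<close> are at most
    \<open>m^2 / 3\<close>, so \<open>m^2 \<le> 2 m^2 / 3\<close>.\<close>
  ultimately have "m\<^sup>2 \<le> 0" by (simp add: power2_eq_square)
  thus False using m \<open>s ^ 3 \<ge> 1\<close> by simp
qed

section \<open>The house and its rainbow copies in a complete graph\<close>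

text \<open>In this labelling the roof is the triangle 0, 2, 4 and the walls form the 4-cycle 0, 3,
  1, 4; they share the edge \<open>{0,4}\<close>.\<close>

lemma edges_house: "edges house = {{0,2},{0,3},{0,4},{1,3},{1,4},{2,4}}"
proof -
  have "edges house = {e. e \<subseteq> {..<5} \<and> card e = 2} - {{i, Suc i} | i. Suc i < 5}"
    by (simp add: house_def complement_def path_graph_def)
  also have "\<dots> = {{0,2},{0,3},{0,4},{1,3},{1,4},{2,4}}"
  proof (rule subset_antisym; rule subsetI)
    fix e :: "nat set"
    assume "e \<in> {e. e \<subseteq> {..<5} \<and> card e = 2} - {{i, Suc i} | i. Suc i < 5}"
    hence e: "e \<subseteq> {..<5}" "card e = 2" "e \<notin> {{i, Suc i} | i. Suc i < 5}" by blast+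
    obtain i j where ij: "e = {i, j}" "i < j" "i \<in> {..<5}" "j \<in> {..<5}"
      using e(1,2) by (rule card_2_ordered)
    have "j \<noteq> Suc i" using e(3) ij(1,4) unfolding lessThan_iff by blast
    with ij(2,4) have "(i = 0 \<and> (j = 2 \<or> j = 3 \<or> j = 4)) \<or> (i = 1 \<and> (j = 3 \<or> j = 4)) \<or> (i = 2 \<and> j = 4)"
      unfolding lessThan_iff by presburger
    thus "e \<in> {{0,2},{0,3},{0,4},{1,3},{1,4},{2,4}}" 
      unfolding ij(1) by (elim disjE conjE; hypsubst; simp only: insert_iff simp_thms)
  next
    fix e :: "nat set"
    have in_house: "{i, j} \<in> {e. e \<subseteq> {..<5} \<and> card e = 2} - {{i, Suc i} | i. Suc i < 5}"
      if "Suc i < j" "j < 5" for i j :: nat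
    proof -
      have "{i, j} \<noteq> {l, Suc l}" for l using that by (auto simp: doubleton_eq_iff)
      hence "{i, j} \<notin> {{i, Suc i} | i. Suc i < 5}" by blast
      thus ?thesis using that by simp
    qed
    assume "e \<in> {{0,2},{0,3},{0,4},{1,3},{1,4},{2,4}}"
    thus "e \<in> {e. e \<subseteq> {..<5} \<and> card e = 2} - {{i, Suc i} | i. Suc i < 5}"
      by (elim insertE emptyE; simp only:; intro in_house; simp)
  qed
  finally show ?thesis .
qed

lemma verts_house: "verts house = {..<5}"
  by (simp add: house_def complement_def path_graph_def)

text \<open>In a complete host every injection of the vertices of \<open>F\<close> carries
  \<open>F\<close> to a copy, so only the colours on the image edges remain to be checked.\<close>

lemma has_rainbow_copy_complete_iff:
  assumes "simple_graph F"
  shows "has_rainbow_copy (complete_graph n) c F \<longleftrightarrow>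
    (\<exists>f. inj_on f (verts F) \<and> f ` verts F \<subseteq> {..<n} \<and> inj_on c ((`) f ` edges F))"
proof
  assume "has_rainbow_copy (complete_graph n) c F"
  then obtain S g where S: "subgraph S (complete_graph n)" "inj_on c (edges S)"
    and g: "bij_betw g (verts S) (verts F)"
      "\<And>u v. u \<in> verts S \<Longrightarrow> v \<in> verts S \<Longrightarrow> {u, v} \<in> edges S \<longleftrightarrow> {g u, g v} \<in> edges F"
    unfolding has_rainbow_copy_def isomorphic_def by blast
  \<comment> \<open>Isomorphisms go from the copy to \<open>F\<close>, while the embedding goes the
    other way.\<close>
  define f where "f = inv_into (verts S) g"
  have f: "bij_betw f (verts F) (verts S)"
    unfolding f_def using g(1) by (rule bij_betw_inv_into)
  have gf: "g (f x) = x" "f x \<in> verts S" if "x \<in> verts F" for x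
    using g(1) f that by (auto simp: f_def bij_betw_inv_into_right dest: bij_betwE)
  have "(`) f ` edges F \<subseteq> edges S"
  proof safe
    fix e assume e: "e \<in> edges F"
    then obtain x y where "e = {x, y}" "x \<in> verts F" "y \<in> verts F"
      using assms by (fastforce simp: simple_graph_def card_2_iff)
    thus "f ` e \<in> edges S" using e g(2)[of "f x" "f y"] by (simp add: gf)
  qed
  hence "inj_on c ((`) f ` edges F)" using S(2) by (rule inj_on_subset[rotated])
  moreover have "f ` verts F \<subseteq> {..<n}"
    using f S(1) by (auto simp: bij_betw_def subgraph_def complete_graph_def)
  ultimately show "\<exists>f. inj_on f (verts F) \<and> f ` verts F \<subseteq> {..<n} \<and> inj_on c ((`) f ` edges F)"
    using f by (auto simp: bij_betw_def)
next
  assume "\<exists>f. inj_on f (verts F) \<and> f ` verts F \<subseteq> {..<n} \<and> inj_on c ((`) f ` edges F)"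
  then obtain f where f: "inj_on f (verts F)" "f ` verts F \<subseteq> {..<n}" "inj_on c ((`) f ` edges F)"
    by blast
  define S where "S = (f ` verts F, (`) f ` edges F)"
  have edges: "e \<subseteq> verts F" "card e = 2" if "e \<in> edges F" for e
    using assms that by (auto simp: simple_graph_def)
  have "card (f ` e) = 2" if "e \<in> edges F" for e
    using edges[OF that] f(1) by (metis card_image inj_on_subset)
  hence "subgraph S (complete_graph n)"
    using edges f(2) unfolding subgraph_def simple_graph_def S_def complete_graph_def
    by (simp add: image_subset_iff subset_iff) blast
  moreover have "isomorphic S F"
    unfolding isomorphic_def
  proof (intro exI[of _ "inv_into (verts F) f"] conjI ballI)
    show "bij_betw (inv_into (verts F) f) (verts S) (verts F)"
      unfolding S_def using f(1) by (simp add: bij_betw_inv_into inj_on_imp_bij_betw)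
    fix u v assume "u \<in> verts S" "v \<in> verts S"
    then obtain x y where xy: "x \<in> verts F" "y \<in> verts F" "u = f x" "v = f y"
      by (auto simp: S_def)
    have "f ` {x, y} \<in> (`) f ` edges F \<longleftrightarrow> {x, y} \<in> edges F"
      using f(1) edges(1) xy by (auto simp: inj_on_image_eq_iff simp del: image_insert)
    thus "{u, v} \<in> edges S \<longleftrightarrow> {inv_into (verts F) f u, inv_into (verts F) f v} \<in> edges F"
      using xy f(1) by (simp add: S_def)
  qed
  ultimately show "has_rainbow_copy (complete_graph n) c F"
    using f(3) unfolding has_rainbow_copy_def by (intro exI[of _ S]) (simp add: S_def)
qed

lemma has_rainbow_house_iff:
  "has_rainbow_copy (complete_graph n) c house \<longleftrightarrow>
    (\<exists>v0 v1 v2 v3 v4. distinct [v0, v1, v2, v3, v4] \<and> {v0, v1, v2, v3, v4} \<subseteq> {..<n} \<and>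
      distinct (map c [{v0,v2},{v0,v3},{v0,v4},{v1,v3},{v1,v4},{v2,v4}]))"
    (is "?L \<longleftrightarrow> ?R")
proof -
  have "simple_graph house"
    by (auto simp: simple_graph_def house_def complement_def)
  note iff = has_rainbow_copy_complete_iff[OF this]
  have V: "{..<5::nat} = {0,1,2,3,4}" by auto
  \<comment> \<open>The six image edges are pairwise distinct, so injectivity of \<open>c\<close> on
    them amounts to distinctness of the list of their colours.\<close>
  have colours: "inj_on c ((`) f ` edges house) \<longleftrightarrow>
      distinct (map c [{f 0,f 2},{f 0,f 3},{f 0,f 4},{f 1,f 3},{f 1,f 4},{f 2,f 4}])"
    if "distinct [f 0, f 1, f 2, f 3, f 4]" for f :: "nat \<Rightarrow> nat"
  proof -
    let ?es = "[{f 0,f 2},{f 0,f 3},{f 0,f 4},{f 1,f 3},{f 1,f 4},{f 2,f 4}]"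
    have "(`) f ` edges house = set ?es" by (simp add: edges_house)
    moreover have "distinct ?es" using that by (auto simp: doubleton_eq_iff)
    ultimately show ?thesis by (simp only: distinct_map) simp
  qed
  show ?thesis
  proof
    assume ?L
    then obtain f where f: "inj_on f {..<5}" "f ` {..<5} \<subseteq> {..<n}" "inj_on c ((`) f ` edges house)"
      unfolding iff verts_house by blast
    have "distinct [f 0, f 1, f 2, f 3, f 4]"
      using f(1) unfolding V by (auto simp: inj_on_def)
    moreover have "{f 0, f 1, f 2, f 3, f 4} \<subseteq> {..<n}" using f(2) unfolding V by simp
    ultimately show ?R using f(3) colours by blast
  next
    assume ?R
    then obtain v0 v1 v2 v3 v4 where v: "distinct [v0, v1, v2, v3, v4]" "{v0, v1, v2, v3, v4} \<subseteq> {..<n}"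
      "distinct (map c [{v0,v2},{v0,v3},{v0,v4},{v1,v3},{v1,v4},{v2,v4}])" by blast
    define f where "f = (!) [v0, v1, v2, v3, v4]"
    have [simp]: "f 0 = v0" "f 1 = v1" "f (Suc 0) = v1" "f 2 = v2" "f 3 = v3" "f 4 = v4" by (simp_all add: f_def)
    have "inj_on f {..<5}" using v(1) unfolding V by (auto simp: inj_on_def)
    moreover have "f ` {..<5} \<subseteq> {..<n}" using v(2) unfolding V by auto
    moreover have "inj_on c ((`) f ` edges house)" using colours[of f] v(1,3) by simp
    ultimately show ?L unfolding iff verts_house by blast
  qed
qed

section \<open>Upper bound: a rainbow \<open>K_{2,4}\<close> forces a rainbow house\<close>

lemma rainbow_K24_imp_rainbow_house:
  fixes u v x1 x2 x3 x4 :: nat and c :: "nat set \<Rightarrow> 'c"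
  assumes "distinct [u, v, x1, x2, x3, x4]" "{u, v, x1, x2, x3, x4} \<subseteq> {..<n}"
    and "inj_on c R" "{{u,x1},{u,x2},{u,x3},{u,x4},{v,x1},{v,x2},{v,x3},{v,x4}} \<subseteq> R"
  shows "has_rainbow_copy (complete_graph n) c house"
proof (rule ccontr)
  assume no: "\<not> ?thesis"
  have "distinct [{u,x1},{u,x2},{u,x3},{u,x4},{v,x1},{v,x2},{v,x3},{v,x4}]"
    using assms(1) by (auto simp: doubleton_eq_iff)
  hence dist: "distinct (map c [{u,x1},{u,x2},{u,x3},{u,x4},{v,x1},{v,x2},{v,x3},{v,x4}])"
    unfolding distinct_map using inj_on_subset[OF assms(3,4)] by simp
  have house: "\<not> distinct (map c [{v0,v2},{v0,v3},{v0,v4},{v1,v3},{v1,v4},{v2,v4}])"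
    if "distinct [v0, v1, v2, v3, v4]" "{v0, v1, v2, v3, v4} \<subseteq> {..<n}" for v0 v1 v2 v3 v4
    using no that unfolding has_rainbow_house_iff by blast
  \<comment> \<open>This is stated for arbitrary \<open>u\<close>, \<open>v\<close> because it is
    used again with the two exchanged.\<close>
  have chord: "c {x1, x2} \<in> {c {u,x1}, c {u,x2}}"
    if "distinct [u, v, x1, x2, x3, x4]" "{u, v, x1, x2, x3, x4} \<subseteq> {..<n}"
      and dist: "distinct (map c [{u,x1},{u,x2},{u,x3},{u,x4},{v,x1},{v,x2},{v,x3},{v,x4}])"
    for u v
  proof -
    have last: "g \<in> {a1, a2, a3, a4, a5}"
      if "\<not> distinct [a1, a2, a3, a4, a5, g]" "distinct [a1, a2, a3, a4, a5]"
      for a1 a2 a3 a4 a5 g :: 'c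
      using that by auto
    have comm: "{x2, x1} = {x1, x2}" by blast
    \<comment> \<open>Each house has roof \<open>u\<close>, \<open>x1\<close>, \<open>x2\<close> and
      a 4-cycle through \<open>u\<close>, \<open>v\<close>, one of \<open>x1\<close>,
      \<open>x2\<close> and one of \<open>x3\<close>, \<open>x4\<close>. Its edges other than
      \<open>x1 x2\<close> are rainbow, so the chord repeats one of their five colours.\<close>
    have "c {x1,x2} \<in> {c {u,x2}, c {u,x3}, c {u,x1}, c {v,x3}, c {v,x1}}"
      using house[of u v x2 x3 x1] that(1,2) dist unfolding comm list.map by (intro last) auto
    moreover have "c {x1,x2} \<in> {c {u,x2}, c {u,x4}, c {u,x1}, c {v,x4}, c {v,x1}}"
      using house[of u v x2 x4 x1] that(1,2) dist unfolding comm list.map by (intro last) auto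
    moreover have "c {x1,x2} \<in> {c {u,x1}, c {u,x3}, c {u,x2}, c {v,x3}, c {v,x2}}"
      using house[of u v x1 x3 x2] that(1,2) dist unfolding comm list.map by (intro last) auto
    moreover have "c {x1,x2} \<in> {c {u,x1}, c {u,x4}, c {u,x2}, c {v,x4}, c {v,x2}}"
      using house[of u v x1 x4 x2] that(1,2) dist unfolding comm list.map by (intro last) auto
    \<comment> \<open>Varying \<open>x3\<close> against \<open>x4\<close> removes the colours at
      these vertices; varying which of \<open>x1\<close>, \<open>x2\<close> lies on the 4-cycle
      removes those of \<open>v x1\<close> and \<open>v x2\<close>.\<close>
    moreover have "g \<in> {a1, a2}"
      if "distinct [a1, a2, a3, a4, b1, b2, b3, b4]"
        and "g \<in> {a2, a3, a1, b3, b1}" "g \<in> {a2, a4, a1, b4, b1}"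
        and "g \<in> {a1, a3, a2, b3, b2}" "g \<in> {a1, a4, a2, b4, b2}"
      for a1 a2 a3 a4 b1 b2 b3 b4 g :: 'c
      using that by auto
    ultimately show ?thesis using dist unfolding list.map by blast
  qed
  have "c {x1, x2} \<in> {c {u,x1}, c {u,x2}}"
    using assms(1,2) dist by (rule chord)
  moreover have "c {x1, x2} \<in> {c {v,x1}, c {v,x2}}"
    using assms(1,2) dist by (intro chord[of v u]) auto
  ultimately show False using dist by auto
qed

lemma rainbow_house_exists:
  assumes n: "n \<ge> 1" and big: "real (num_colours (complete_graph n) c) \<ge> 3 * real n powr (3/2)"
  shows "has_rainbow_copy (complete_graph n) c house"
proof -
  \<comment> \<open>\<open>R\<close> holds one representative edge of each colour.\<close>
  obtain R where R: "R \<subseteq> edges (complete_graph n)" "inj_on c R" "c ` R = c ` edges (complete_graph n)"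
    by (metis order_refl subset_image_inj)
  have "num_colours (complete_graph n) c = card R"
    unfolding num_colours_def using R by (metis card_image)
  hence "real (card R) \<ge> 3 * real n powr (3/2)" using big by simp
  then obtain u v where uv: "u < n" "v < n" "u \<noteq> v"
      "card {x \<in> {..<n}. {x, u} \<in> R \<and> {x, v} \<in> R} \<ge> 4"
    by (rule codegree_4_exists[OF R(1) n])
  obtain Y where Y: "Y \<subseteq> {x \<in> {..<n}. {x, u} \<in> R \<and> {x, v} \<in> R}" "card Y = 4" "finite Y"
    by (rule obtain_subset_with_card_n[OF uv(4)])
  obtain xs where xs: "set xs = Y" "distinct xs"
    using finite_distinct_list[OF Y(3)] by blast
  obtain x1 x2 x3 x4 where x: "xs = [x1, x2, x3, x4]"
    using Y(2) distinct_card[OF xs(2)] unfolding xs(1) by (auto simp: length_Suc_conv numeral_eq_Suc)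
  \<comment> \<open>\<open>R\<close> has no loops, so neither \<open>u\<close> nor \<open>v\<close>
    is among their common neighbours.\<close>
  have "{a} \<notin> R" for a using R(1) by (auto simp: complete_graph_def)
  hence "u \<notin> Y" "v \<notin> Y" using Y(1) by auto
  hence "distinct [u, v, x1, x2, x3, x4]" using xs(1,2) uv(3) unfolding x by auto
  moreover have "{u, v, x1, x2, x3, x4} \<subseteq> {..<n}"
    using Y(1) uv(1,2) unfolding xs(1)[symmetric] x by simp
  moreover have "{{u,x1},{u,x2},{u,x3},{u,x4},{v,x1},{v,x2},{v,x3},{v,x4}} \<subseteq> R"
    using Y(1) unfolding xs(1)[symmetric] x by (simp add: insert_commute)
  ultimately show ?thesis
    using R(2) by (intro rainbow_K24_imp_rainbow_house)
qed

lemma rainbow_number_le: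
  assumes "n \<ge> 1"
  shows "real (rainbow_number (complete_graph n) house) \<le> 4 * real n powr (3/2)"
proof -
  let ?m = "nat \<lceil>3 * real n powr (3/2)\<rceil>"
  have "rainbow_number (complete_graph n) house \<le> ?m"
    unfolding rainbow_number_def
  proof (rule Least_le, intro allI impI)
    fix c :: "nat set \<Rightarrow> nat" assume "?m \<le> num_colours (complete_graph n) c"
    hence "3 * real n powr (3/2) \<le> real (num_colours (complete_graph n) c)" by linarith
    thus "has_rainbow_copy (complete_graph n) c house" using rainbow_house_exists assms by blast
  qed
  \<comment> \<open>Rounding up costs at most 1, which is absorbed in passing from 3 to 4.\<close>
  moreover have "real n powr (3/2) \<ge> 1" using assms by (simp add: ge_one_powr_ge_zero)
  ultimately show ?thesis by linarith
qed

section \<open>Lower bound from the incidence graph\<close>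

lemma num_colours_le_card_edges: "num_colours (complete_graph n) c \<le> card (edges (complete_graph n))"
  unfolding num_colours_def by (rule card_image_le) (simp add: complete_graph_def)

lemma rainbow_number_gt:
  assumes "q = 2 ^ k" "k \<ge> 1" and n: "2 * q\<^sup>2 \<le> n"
  shows "rainbow_number (complete_graph n) house > q ^ 3"
proof -
  obtain E where E: "E \<subseteq> {..<q\<^sup>2} \<times> {q\<^sup>2..<2 * q\<^sup>2}" "card E = q ^ 3"
    and C4: "\<And>i i' j j'. \<lbrakk>(i, j) \<in> E; (i, j') \<in> E; (i', j) \<in> E; (i', j') \<in> E\<rbrakk> \<Longrightarrow> i = i' \<or> j = j'"
    using C4_free_bipartite_exists[OF assms(1,2)] by metis
  define B where "B = (\<lambda>(i, j). {i, j}) ` E"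
  have E_side: "i < q\<^sup>2" "q\<^sup>2 \<le> j" "j < 2 * q\<^sup>2" if "(i, j) \<in> E" for i j
    using E(1) that by auto
  have "inj_on (\<lambda>(i, j). {i, j}) E"
    \<comment> \<open>The smaller endpoint is the line, so the ordered pair can be recovered from
      the edge.\<close>
    by (rule inj_onI) (clarsimp simp: doubleton_eq_iff, metis E_side(1,2) leD)
  hence card_B: "card B = q ^ 3" by (simp add: B_def card_image E(2))
  have B_edges: "B \<subseteq> edges (complete_graph n)"
  proof
    fix e assume "e \<in> B"
    then obtain i j where "e = {i, j}" "(i, j) \<in> E" by (auto simp: B_def)
    thus "e \<in> edges (complete_graph n)"
      using E_side[of i j] n by (simp add: complete_graph_def)
  qed
  \<comment> \<open>From here on, bipartiteness and the absence of 4-cycles are restated for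
    unordered edges, where either endpoint may be the line.\<close>
  have B_iff: "{x, y} \<in> B \<longleftrightarrow> (x, y) \<in> E \<or> (y, x) \<in> E" for x y
    by (auto simp: B_def image_iff doubleton_eq_iff)
  have side: "x < q\<^sup>2 \<longleftrightarrow> \<not> y < q\<^sup>2" if "{x, y} \<in> B" for x y
    using that E_side[of x y] E_side[of y x] unfolding B_iff by linarith
  have C4_B: "x = x' \<or> y = y'"
    if "{x, y} \<in> B" "{x, y'} \<in> B" "{x', y} \<in> B" "{x', y'} \<in> B" for x x' y y'
  proof (cases "x < q\<^sup>2")
    case True
    hence "(x, y) \<in> E" "(x, y') \<in> E" "(x', y) \<in> E" "(x', y') \<in> E"
      using that side[OF that(1)] side[OF that(2)] side[OF that(3)] unfolding B_iff by (metis E_side(1,2) leD)+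
    thus ?thesis using C4 by blast
  next
    case False
    hence "(y, x) \<in> E" "(y', x) \<in> E" "(y, x') \<in> E" "(y', x') \<in> E"
      using that side[OF that(1)] side[OF that(2)] side[OF that(3)] unfolding B_iff by (metis E_side(1,2) leD)+
    thus ?thesis using C4 by blast
  qed
  have "finite B"
    using finite_subset[OF E(1)] unfolding B_def by simp
  then obtain g :: "nat set \<Rightarrow> nat" where g: "inj_on g B"
    using finite_imp_inj_to_nat_seg[of B] by blast
  \<comment> \<open>Colour 0 is the common colour outside \<open>B\<close>; \<open>Suc\<close> keeps
    it apart from the colours on \<open>B\<close>.\<close>
  define c :: "nat set \<Rightarrow> nat" where "c e = (if e \<in> B then Suc (g e) else 0)" for e
  have "inj_on c B" using g by (auto simp: c_def inj_on_def)
  hence "q ^ 3 = card (c ` B)" by (simp add: card_image card_B)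
  also have "\<dots> \<le> num_colours (complete_graph n) c"
    unfolding num_colours_def using B_edges by (intro card_mono) (auto simp: complete_graph_def)
  finally have many: "q ^ 3 \<le> num_colours (complete_graph n) c" .
  have no: "\<not> has_rainbow_copy (complete_graph n) c house"
  proof
    assume "has_rainbow_copy (complete_graph n) c house"
    then obtain v0 v1 v2 v3 v4 where v: "distinct [v0, v1, v2, v3, v4]"
      "distinct (map c [{v0,v2},{v0,v3},{v0,v4},{v1,v3},{v1,v4},{v2,v4}])"
      unfolding has_rainbow_house_iff by blast
    have one: "e \<in> B \<or> e' \<in> B" if "c e \<noteq> c e'" for e e'
      using that unfolding c_def by metis
    \<comment> \<open>The roof is an odd cycle, so one of its edges lies outside \<open>B\<close>,
      and by \<open>one\<close> all other edges of the house lie in \<open>B\<close>. Without the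
      shared edge \<open>v0 v4\<close> a 5-cycle remains; without another roof edge the 4-cycle of
      the walls remains.\<close>
    consider "{v0,v2} \<notin> B" | "{v0,v4} \<notin> B" | "{v2,v4} \<notin> B"
      using side by blast
    thus False
    proof cases
      case 2
      hence "{v0,v2} \<in> B" "{v0,v3} \<in> B" "{v1,v3} \<in> B" "{v1,v4} \<in> B" "{v2,v4} \<in> B"
        using v(2) one by auto
      thus False using side by blast
    next
      case 1
      hence "{v0,v3} \<in> B" "{v0,v4} \<in> B" "{v1,v3} \<in> B" "{v1,v4} \<in> B"
        using v(2) one by auto
      thus False using C4_B v(1) by fastforce
    next
      case 3
      hence "{v0,v3} \<in> B" "{v0,v4} \<in> B" "{v1,v3} \<in> B" "{v1,v4} \<in> B"
        using v(2) one by auto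
      thus False using C4_B v(1) by fastforce
    qed
  qed
  define P where "P m \<longleftrightarrow> (\<forall>c :: nat set \<Rightarrow> nat. num_colours (complete_graph n) c \<ge> m \<longrightarrow>
      has_rainbow_copy (complete_graph n) c house)" for m
  \<comment> \<open>\<open>LeastI\<close> needs some threshold that works; this one does
    vacuously.\<close>
  have "P (Suc (card (edges (complete_graph n))))"
    unfolding P_def using num_colours_le_card_edges by (metis not_less_eq_eq)
  hence "P (rainbow_number (complete_graph n) house)"
    unfolding rainbow_number_def P_def by (rule LeastI)
  thus ?thesis using many no unfolding P_def by (meson leI le_trans)
qed

text \<open>Take the largest \<open>k\<close> with \<open>2 * 4^k \<le> n\<close>. Maximality gives
  \<open>n < 8 * 4^k\<close>, so \<open>q^2\<close> exceeds \<open>n / 8\<close>; this is the source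
  of the constant. The bound \<open>n \<ge> 8\<close> ensures \<open>k \<ge> 1\<close>.\<close>

lemma rainbow_number_ge:
  assumes n: "n \<ge> 8"
  shows "real (rainbow_number (complete_graph n) house) \<ge> (1/8) powr (3/2) * real n powr (3/2)"
proof -
  define k where "k = nat \<lfloor>log 4 (real n / 2)\<rfloor>"
  define q :: nat where "q = 2 ^ k"
  have "log 4 (real n / 2) \<ge> 1" using n by (simp add: le_log_iff)
  hence k: "k \<ge> 1" "real k \<le> log 4 (real n / 2)" "log 4 (real n / 2) < real k + 1"
    unfolding k_def by linarith+
  have q2: "q\<^sup>2 = 4 ^ k" unfolding q_def by (simp add: power_mult[symmetric] mult.commute[of k] power_mult)
  have "4 powr real k \<le> real n / 2" using k(2) n by (simp add: le_log_iff)
  hence "real (2 * q\<^sup>2) \<le> real n" by (simp add: q2 powr_realpow)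
  hence "2 * q\<^sup>2 \<le> n" by (simp only: of_nat_le_iff)
  hence gt: "rainbow_number (complete_graph n) house > q ^ 3"
    using rainbow_number_gt[OF q_def k(1)] by blast
  have "real n / 2 < 4 powr (real k + 1)" using k(3) n by (simp add: log_less_iff)
  hence "real n / 8 \<le> (real q)\<^sup>2"
    using arg_cong[OF q2, of real] by (simp add: powr_add powr_realpow)
  hence "(real n / 8) powr (3/2) \<le> ((real q)\<^sup>2) powr (3/2)" by (intro powr_mono2) auto
  also have "\<dots> = real q ^ 3"
    by (rule power2_powr_three_halves) (simp add: q_def)
  also have "\<dots> \<le> real (rainbow_number (complete_graph n) house)"
    using gt by (simp flip: of_nat_power)
  finally show ?thesis by (simp add: powr_divide)
qed

theorem theorem13:
  "(\<lambda>n. real (rainbow_number (complete_graph n) house)) \<in> \<Theta>(\<lambda>n. real n powr (3 / 2))"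
proof (rule bigthetaI)
  show "(\<lambda>n. real (rainbow_number (complete_graph n) house)) \<in> O(\<lambda>n. real n powr (3 / 2))"
    using rainbow_number_le
    by (intro bigoI[of _ 4] eventually_at_top_linorderI[of 1]) auto
  show "(\<lambda>n. real (rainbow_number (complete_graph n) house)) \<in> \<Omega>(\<lambda>n. real n powr (3 / 2))"
    using rainbow_number_ge
    by (intro landau_omega.bigI[of "(1/8) powr (3/2)"] eventually_at_top_linorderI[of 8]) auto
qed

end
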